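(* Let $n\ge3$ and $1\le j<n/2$ be integers, $\alpha=\pi/n$, $v=\cos\alpha$, $\theta=(n-2j)\pi/n$, $C=\cos\theta$ and $$\lambda(n,j)=\frac{v\,(2v^2-1-C)}{C-1}.$$ Then $\lambda(n,j)=0$ if and only if $\theta=2\alpha$, i.e. if and only if $j=(n-2)/2$, and $(n-2)/2$ is an integer if and only if $n$ is even. Thus the centrally projective construction on the regular $n$-gon is the $\lambda=0$ member of the family of billiards $\{\mathcal{B}(n,j):1\le j<n/2\}$ exactly for even $n$, and for odd $n$ it does not belong to this family.
   Context: For integers $n\ge3$ and $1\le j<n/2$, $\mathcal{B}(n,j)$ denotes the projective billiard on the regular $n$-gon with vertices $V_i=(\cos 2i\alpha,\sin 2i\alpha)$, $\alpha=\pi/n$, in which the transversal line field on the side $V_iV_{i+1}$ is the pencil of lines through the point $O_i=-\lambda(n,j)\widehat M_i$, where $\widehat M_i$ is the unit vector from the origin towards the midpoint of $V_iV_{i+1}$. (A projective billiard is a domain with a transversal line at each boundary point, the reflection law being that the incoming line, outgoing line, tangent and transversal have cross ratio $-1$.) The centrally projective construction on the regular $n$-gon is the projective billiard for which, on every side, the transversal field is the pencil through the centre of the polygon (the origin), i.e. all $O_i$ are the centre, $\lambda=0$. *)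

theory Defs
  imports "HOL-Analysis.Analysis"
begin

type_synonym plane = "real \<times> real"

text \<open>
  A projective billiard is a domain together with a transversal line at the points of its
  boundary; the reflection law (incoming line, outgoing line, tangent and transversal have
  cross ratio \<open>-1\<close>) is determined by these data.  The line field is stored as a set of pairs
  (boundary point, line), because no line is prescribed at the vertices of a polygon.
\<close>

record projective_billiard =
  domain :: "plane set"
  transversal_field :: "(plane \<times> plane set) set"

definition alpha :: "nat \<Rightarrow> real" where
  "alpha n = pi / real n"

definition vertex :: "nat \<Rightarrow> nat \<Rightarrow> plane" where
  "vertex n i = (cos (2 * real i * alpha n), sin (2 * real i * alpha n))"

text \<open>
  Sides are indexed by \<open>i < n\<close>; the last one ends at \<open>vertex n n\<close>, which equals \<open>vertex n 0\<close>.
\<close>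

definition side :: "nat \<Rightarrow> nat \<Rightarrow> plane set" where
  "side n i = open_segment (vertex n i) (vertex n (Suc i))"

definition regular_polygon :: "nat \<Rightarrow> plane set" where
  "regular_polygon n = convex hull (vertex n ` {..<n})"

definition polygon_pencil_billiard :: "nat \<Rightarrow> (nat \<Rightarrow> plane) \<Rightarrow> projective_billiard" where
  "polygon_pencil_billiard n P =
     \<lparr> domain = interior (regular_polygon n),
       transversal_field = {(p, affine hull {P i, p}) | i p. i < n \<and> p \<in> side n i} \<rparr>"

definition unit_mid :: "nat \<Rightarrow> nat \<Rightarrow> plane" where
  "unit_mid n i = sgn (midpoint (vertex n i) (vertex n (Suc i)))"

definition theta :: "nat \<Rightarrow> nat \<Rightarrow> real" where
  "theta n j = (real n - 2 * real j) * pi / real n"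

definition lam :: "nat \<Rightarrow> nat \<Rightarrow> real" where
  "lam n j = (let v = cos (alpha n); C = cos (theta n j)
              in v * (2 * v\<^sup>2 - 1 - C) / (C - 1))"

definition billiard :: "nat \<Rightarrow> nat \<Rightarrow> projective_billiard" where
  "billiard n j = polygon_pencil_billiard n (\<lambda>i. - lam n j *\<^sub>R unit_mid n i)"

definition billiard_family :: "nat \<Rightarrow> projective_billiard set" where
  "billiard_family n = {billiard n j | j. 1 \<le> j \<and> real j < real n / 2}"

definition centrally_projective_billiard :: "nat \<Rightarrow> projective_billiard" where
  "centrally_projective_billiard n = polygon_pencil_billiard n (\<lambda>i. 0)"

text \<open>
  The lines of a pencil through a point off the side are indeed transversal to that side, and
  the centres of the pencils used above are off the sides.
\<close>

lemma pencil_transversal: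
  assumes O: "O' \<notin> affine hull {vertex n i, vertex n (Suc i)}" and p: "p \<in> side n i"
  shows "aff_dim (affine hull {O', p}) = 1"
    and "affine hull {O', p} \<inter> affine hull {vertex n i, vertex n (Suc i)} = {p}"
proof -
  let ?S = "affine hull {vertex n i, vertex n (Suc i)}"
  have pS: "p \<in> ?S"
    using p convex_hull_subset_affine_hull[of "{vertex n i, vertex n (Suc i)}"]
    unfolding side_def open_segment_def segment_convex_hull by auto
  have ne: "O' \<noteq> p" using O pS by blast
  then show "aff_dim (affine hull {O', p}) = 1"
    by (simp add: aff_dim_2)
  have "q = p" if q: "q \<in> affine hull {O', p}" "q \<in> ?S" for q
  proof (rule ccontr)
    assume "q \<noteq> p"
    obtain s t where st: "q = s *\<^sub>R O' + t *\<^sub>R p" "s + t = 1"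
      using q(1) by (auto simp: affine_hull_2)
    have "s \<noteq> 0" using st \<open>q \<noteq> p\<close> by auto
    have "O' = (1/s) *\<^sub>R q + (- t/s) *\<^sub>R p"
      using \<open>s \<noteq> 0\<close> by (simp add: st(1) scaleR_add_right)
    moreover have "1/s + (- t/s) = 1" using \<open>s \<noteq> 0\<close> st(2) by (simp add: field_simps)
    ultimately have "O' \<in> ?S"
      using mem_affine[OF affine_affine_hull q(2) pS] by metis
    with O show False by blast
  qed
  then show "affine hull {O', p} \<inter> ?S = {p}"
    using pS hull_inc[of p "{O', p}" affine] by auto
qed

lemma unit_mid_eq:
  assumes "n \<ge> 3"
  shows "unit_mid n i = (cos ((2 * real i + 1) * alpha n), sin ((2 * real i + 1) * alpha n))"
proof -
  let ?b = "(2 * real i + 1) * alpha n" and ?a = "alpha n"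
  have a: "0 < ?a" "?a < pi / 2" using assms by (auto simp: alpha_def field_simps)
  then have c: "cos ?a > 0" by (intro cos_gt_zero) auto
  have 1: "2 * real i * ?a = ?b - ?a" "2 * real (Suc i) * ?a = ?b + ?a"
    by (simp_all add: algebra_simps)
  have "midpoint (vertex n i) (vertex n (Suc i)) = cos ?a *\<^sub>R (cos ?b, sin ?b)"
    unfolding vertex_def 1 midpoint_def by (simp add: cos_add cos_diff sin_add sin_diff)
  then have "unit_mid n i = sgn (cos ?a) *\<^sub>R sgn (cos ?b, sin ?b)"
    unfolding unit_mid_def by (simp only: sgn_scaleR)
  also have "\<dots> = (cos ?b, sin ?b)"
    using c by (simp add: sgn_div_norm norm_Pair)
  finally show ?thesis .
qed

lemma off_side:
  assumes n: "n \<ge> 3" and c: "c \<noteq> cos (alpha n)"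
  shows "c *\<^sub>R unit_mid n i \<notin> affine hull {vertex n i, vertex n (Suc i)}"
proof
  let ?b = "(2 * real i + 1) * alpha n" and ?a = "alpha n"
  have 1: "2 * real i * ?a = ?b - ?a" "2 * real (Suc i) * ?a = ?b + ?a"
    by (simp_all add: algebra_simps)
  have sq: "cos ?b * cos ?b + sin ?b * sin ?b = 1"
    by (metis power2_eq_square sin_cos_squared_add2)
  have V: "vertex n i \<bullet> unit_mid n i = cos ?a" "vertex n (Suc i) \<bullet> unit_mid n i = cos ?a"
    using cos_diff[of "?b - ?a" ?b] cos_diff[of "?b + ?a" ?b]
    unfolding vertex_def 1 unit_mid_eq[OF n] inner_prod_def by simp_all
  assume "c *\<^sub>R unit_mid n i \<in> affine hull {vertex n i, vertex n (Suc i)}"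
  then obtain s t where st: "s + t = 1"
    "c *\<^sub>R unit_mid n i = s *\<^sub>R vertex n i + t *\<^sub>R vertex n (Suc i)"
    by (auto simp: affine_hull_2)
  have "c * (unit_mid n i \<bullet> unit_mid n i) = s * cos ?a + t * cos ?a"
    using arg_cong[OF st(2), of "\<lambda>x. x \<bullet> unit_mid n i"] by (simp add: inner_add_left V)
  moreover have "unit_mid n i \<bullet> unit_mid n i = 1"
    unfolding unit_mid_eq[OF n] by (simp add: sq)
  ultimately have "c = (s + t) * cos ?a" by (simp add: algebra_simps)
  with st(1) c show False by simp
qed

lemma pencil_centres_off_sides:
  assumes n: "n \<ge> 3"
  shows "0 \<notin> affine hull {vertex n i, vertex n (Suc i)}"
    and "1 \<le> j \<Longrightarrow> real j < real n / 2 \<Longrightarrow>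
      - lam n j *\<^sub>R unit_mid n i \<notin> affine hull {vertex n i, vertex n (Suc i)}"
proof -
  have a: "0 < alpha n" "alpha n < pi / 2" using n by (auto simp: alpha_def field_simps)
  then have v: "0 < cos (alpha n)" "cos (alpha n) < 1"
    using cos_gt_zero cos_monotone_0_pi[of 0 "alpha n"] by auto
  show "0 \<notin> affine hull {vertex n i, vertex n (Suc i)}"
    using off_side[OF n, of 0 i] v by simp
  assume j: "1 \<le> j" "real j < real n / 2"
  have "theta n j = pi - 2 * real j * pi / real n" using n by (simp add: theta_def field_simps)
  moreover have "0 < 2 * real j * pi / real n" "2 * real j * pi / real n < pi"
    using n j by (auto simp: field_simps)
  ultimately have "0 < theta n j" "theta n j < pi" by auto
  then have C: "cos (theta n j) < 1" using cos_monotone_0_pi[of 0 "theta n j"] by auto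
  have "- lam n j \<noteq> cos (alpha n)"
  proof
    assume "- lam n j = cos (alpha n)"
    then have "cos (alpha n) * (2 * (cos (alpha n))\<^sup>2 - 1 - cos (theta n j)) =
        cos (alpha n) * (1 - cos (theta n j))"
      using C by (simp add: lam_def Let_def field_simps)
    then have "(cos (alpha n))\<^sup>2 = 1" using v by simp
    with v show False by (simp add: power2_eq_1_iff)
  qed
  then show "- lam n j *\<^sub>R unit_mid n i \<notin> affine hull {vertex n i, vertex n (Suc i)}"
    by (rule off_side[OF n])
qed

end

theory Submission
  imports Defs
begin

text \<open>
  For \<open>1 \<le> j < n/2\<close> both \<open>theta n j\<close> and \<open>2 * alpha n\<close> lie in \<open>(0, \<pi>)\<close>, where the cosine is
  injective.  The numerator of \<open>lam n j\<close> is \<open>v * (cos (2 * alpha n) - cos (theta n j))\<close> with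
  \<open>v > 0\<close>, so \<open>lam n j\<close> vanishes iff these two angles agree, that is, iff \<open>2 * j + 2 = n\<close>.  All
  claims about \<open>lam\<close> are then parity considerations (\<open>lam_eq_0_iff\<close>).

  The claim that a billiard \<open>billiard n j\<close> with \<open>lam n j \<noteq> 0\<close> is really different from the
  centrally projective one needs a geometric argument, as distinct pencils could conceivably
  induce the same field of lines.  Let the pencil centres be \<open>c *\<^sub>R unit_mid n i\<close> with \<open>c \<noteq> 0\<close>.
  If the line from this centre to a point \<open>p\<close> of side \<open>i\<close> passes through the origin, then \<open>p\<close>
  is parallel to \<open>unit_mid n i\<close>, hence is the midpoint of the side and has norm
  \<open>cos (alpha n)\<close>.  The point dividing side 0 in the ratio 1:3 has larger norm, so the line
  through it and the origin is not in the field, whichever side it is assigned to.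
  This yields \<open>pencil_billiard_eq_central_iff\<close>.
\<close>

lemma alpha_bounds:
  assumes "n \<ge> 3"
  shows "0 < alpha n" "alpha n < pi / 2"
  using assms by (auto simp: alpha_def field_simps)

lemma cos_alpha_bounds:
  assumes "n \<ge> 3"
  shows "0 < cos (alpha n)" "cos (alpha n) < 1"
  using alpha_bounds[OF assms] cos_gt_zero cos_monotone_0_pi[of 0 "alpha n"] by auto

lemma norm_unit_mid:
  assumes "n \<ge> 3"
  shows "norm (unit_mid n i) = 1"
  by (simp add: unit_mid_eq[OF assms] norm_Pair)

lemma vertex_inner_unit_mid:
  assumes n: "n \<ge> 3"
  shows "vertex n i \<bullet> unit_mid n i = cos (alpha n)"
    and "vertex n (Suc i) \<bullet> unit_mid n i = cos (alpha n)"
proof -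
  let ?b = "(2 * real i + 1) * alpha n" and ?a = "alpha n"
  have 1: "2 * real i * ?a = ?b - ?a" "2 * real (Suc i) * ?a = ?b + ?a"
    by (simp_all add: algebra_simps)
  show "vertex n i \<bullet> unit_mid n i = cos ?a" "vertex n (Suc i) \<bullet> unit_mid n i = cos ?a"
    using cos_diff[of "?b - ?a" ?b] cos_diff[of "?b + ?a" ?b]
    unfolding vertex_def 1 unit_mid_eq[OF n] inner_prod_def by simp_all
qed

lemma side_inner_unit_mid:
  assumes n: "n \<ge> 3" and p: "p \<in> side n i"
  shows "p \<bullet> unit_mid n i = cos (alpha n)"
proof -
  obtain u where u: "p = (1 - u) *\<^sub>R vertex n i + u *\<^sub>R vertex n (Suc i)"
    using p by (auto simp: side_def in_segment)
  show ?thesis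
    unfolding u inner_add_left inner_scaleR_left vertex_inner_unit_mid[OF n]
    by (simp add: algebra_simps)
qed

text \<open>
  Only at the midpoint of a side can the pencils through the origin and through another point of
  the axis of that side share a line.  The conclusion speaks of the norm of \<open>p\<close> because this does
  not depend on \<open>i\<close>, so that disjointness of the sides never has to be discussed.
\<close>

lemma pencil_line_through_origin_norm:
  assumes n: "n \<ge> 3" and p: "p \<in> side n i" and c: "c \<noteq> 0"
    and eq: "affine hull {c *\<^sub>R unit_mid n i, p} = affine hull {0, p}"
  shows "norm p = cos (alpha n)"
proof -
  have "c *\<^sub>R unit_mid n i \<in> affine hull {0, p}"
    unfolding eq[symmetric] by (simp add: hull_inc)
  then obtain t where t: "c *\<^sub>R unit_mid n i = t *\<^sub>R p"
    by (auto simp: affine_hull_2)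
  have "unit_mid n i \<bullet> unit_mid n i = 1"
    by (simp add: dot_square_norm norm_unit_mid[OF n])
  then have ct: "c = t * cos (alpha n)"
    using arg_cong[OF t, of "\<lambda>x. x \<bullet> unit_mid n i"] by (simp add: side_inner_unit_mid[OF n p])
  have "\<bar>c\<bar> = \<bar>t\<bar> * norm p"
    using arg_cong[OF t, of norm] by (simp add: norm_unit_mid[OF n])
  moreover have "\<bar>c\<bar> = \<bar>t\<bar> * cos (alpha n)"
    using ct cos_alpha_bounds(1)[OF n] by (simp add: abs_mult)
  ultimately show ?thesis using c ct by auto
qed

lemma side_has_non_midpoint:
  assumes n: "n \<ge> 3"
  obtains p where "p \<in> side n 0" "norm p \<noteq> cos (alpha n)"
proof
  define p where "p = (1 - 1/4) *\<^sub>R vertex n 0 + (1/4) *\<^sub>R vertex n (Suc 0)"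
  let ?v = "cos (alpha n)"
  have v: "0 < ?v" "?v < 1" using cos_alpha_bounds[OF n] by auto
  have V: "vertex n 0 = (1, 0)" "vertex n (Suc 0) = (2 * ?v\<^sup>2 - 1, sin (2 * alpha n))"
    using cos_double_cos[of "alpha n"] by (simp_all add: vertex_def)
  have v2: "?v\<^sup>2 \<noteq> 1" using v by (simp add: power2_eq_1_iff)
  have "vertex n 0 \<noteq> vertex n (Suc 0)" using v2 V by auto
  then show "p \<in> side n 0"
    unfolding side_def in_segment p_def by (intro conjI exI[of _ "1/4"]) auto
  have "(sin (2 * alpha n))\<^sup>2 = 1 - (2 * ?v\<^sup>2 - 1)\<^sup>2"
    using sin_squared_eq[of "2 * alpha n"] cos_double_cos[of "alpha n"] by simp
  moreover have "(norm p)\<^sup>2 = (3/4 + (2 * ?v\<^sup>2 - 1)/4)\<^sup>2 + (sin (2 * alpha n))\<^sup>2 / 16"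
    unfolding p_def V by (simp add: norm_Pair power_divide)
  ultimately have "(norm p)\<^sup>2 = 1/4 + 3/4 * ?v\<^sup>2"
    by (simp add: power2_eq_square field_simps)
  then show "norm p \<noteq> ?v" using v2 by auto
qed

theorem pencil_billiard_eq_central_iff:
  assumes n: "n \<ge> 3"
  shows "polygon_pencil_billiard n (\<lambda>i. c *\<^sub>R unit_mid n i) = centrally_projective_billiard n
    \<longleftrightarrow> c = 0"
proof
  assume eq: "polygon_pencil_billiard n (\<lambda>i. c *\<^sub>R unit_mid n i) = centrally_projective_billiard n"
  show "c = 0"
  proof (rule ccontr)
    assume c: "c \<noteq> 0"
    obtain p where p: "p \<in> side n 0" "norm p \<noteq> cos (alpha n)"
      using side_has_non_midpoint[OF n] .
    have "(p, affine hull {0, p}) \<in> transversal_field (centrally_projective_billiard n)"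
      using p n unfolding centrally_projective_billiard_def polygon_pencil_billiard_def
      by (simp del: split_paired_Ex) (intro exI[of _ 0] exI[of _ p], simp)
    then obtain i where "p \<in> side n i" "affine hull {c *\<^sub>R unit_mid n i, p} = affine hull {0, p}"
      unfolding eq[symmetric] polygon_pencil_billiard_def by auto
    from pencil_line_through_origin_norm[OF n this(1) c this(2)] p(2) show False by simp
  qed
qed (simp add: centrally_projective_billiard_def)

lemma billiard_eq_central_iff:
  assumes "n \<ge> 3"
  shows "billiard n j = centrally_projective_billiard n \<longleftrightarrow> lam n j = 0"
  using pencil_billiard_eq_central_iff[OF assms, of "- lam n j"] by (simp add: billiard_def)

lemma theta_eq_double_alpha_iff:
  assumes "n \<ge> 3"
  shows "theta n j = 2 * alpha n \<longleftrightarrow> n = 2 * j + 2"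
proof -
  have "theta n j = 2 * alpha n \<longleftrightarrow> real n - 2 * real j = 2"
    using assms by (simp add: theta_def alpha_def)
  also have "\<dots> \<longleftrightarrow> n = 2 * j + 2" by linarith
  finally show ?thesis .
qed

lemma lam_eq_0_iff:
  assumes n: "n \<ge> 3" and j: "1 \<le> j" "real j < real n / 2"
  shows "lam n j = 0 \<longleftrightarrow> theta n j = 2 * alpha n"
proof -
  have \<theta>: "0 < theta n j" "theta n j < pi"
    using n j by (auto simp: theta_def field_simps)
  then have "cos (theta n j) \<noteq> 1"
    using cos_monotone_0_pi[of 0 "theta n j"] by auto
  then have "lam n j = 0 \<longleftrightarrow> cos (theta n j) = cos (2 * alpha n)"
    using cos_alpha_bounds[OF n] by (auto simp: lam_def Let_def cos_double_cos)
  also have "\<dots> \<longleftrightarrow> theta n j = 2 * alpha n"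
    using \<theta> alpha_bounds[OF n] by (auto intro: cos_inj_pi)
  finally show ?thesis .
qed

theorem proposition4p8:
  fixes n :: nat
  assumes "n \<ge> 3"
  shows "(\<forall>j::nat. 1 \<le> j \<and> real j < real n / 2 \<longrightarrow>
            (lam n j = 0 \<longleftrightarrow> theta n j = 2 * alpha n) \<and>
            (lam n j = 0 \<longleftrightarrow> real j = (real n - 2) / 2)) \<and>
         ((real n - 2) / 2 \<in> \<int> \<longleftrightarrow> even n) \<and>
         ({billiard n j | j. 1 \<le> j \<and> real j < real n / 2 \<and> lam n j = 0}
            = {centrally_projective_billiard n} \<longleftrightarrow> even n) \<and>
         (odd n \<longrightarrow> centrally_projective_billiard n \<notin> billiard_family n)"
proof (intro conjI allI impI)
  have lam0: "lam n j = 0 \<longleftrightarrow> n = 2 * j + 2" if "1 \<le> j" "real j < real n / 2" for j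
    using lam_eq_0_iff[OF assms that] theta_eq_double_alpha_iff[OF assms] by simp
  show "lam n j = 0 \<longleftrightarrow> theta n j = 2 * alpha n" if "1 \<le> j \<and> real j < real n / 2" for j
    using lam_eq_0_iff[OF assms] that by blast
  show "lam n j = 0 \<longleftrightarrow> real j = (real n - 2) / 2" if "1 \<le> j \<and> real j < real n / 2" for j
  proof -
    have "real j = (real n - 2) / 2 \<longleftrightarrow> n = 2 * j + 2" by auto
    then show ?thesis using lam0 that by blast
  qed
  show "(real n - 2) / 2 \<in> \<int> \<longleftrightarrow> even n"
  proof
    assume "(real n - 2) / 2 \<in> \<int>"
    then obtain k where "(real n - 2) / 2 = of_int k" by (auto elim: Ints_cases)
    then have "real_of_int (int n) = real_of_int (2 * (k + 1))" by simp
    then have "int n = 2 * (k + 1)" unfolding of_int_eq_iff .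
    then show "even n" by presburger
  next
    assume "even n"
    then obtain m where "n = 2 * m" ..
    then have "(real n - 2) / 2 = of_int (int m - 1)" by simp
    then show "(real n - 2) / 2 \<in> \<int>" by (metis Ints_of_int)
  qed
  show "{billiard n j | j. 1 \<le> j \<and> real j < real n / 2 \<and> lam n j = 0}
      = {centrally_projective_billiard n} \<longleftrightarrow> even n"
  proof
    assume "{billiard n j | j. 1 \<le> j \<and> real j < real n / 2 \<and> lam n j = 0}
      = {centrally_projective_billiard n}"
    then obtain j where "1 \<le> j" "real j < real n / 2" "lam n j = 0" by blast
    then show "even n" using lam0 by simp
  next
    assume "even n"
    then obtain m where m: "n = 2 * m" ..
    \<comment> \<open>As \<open>n\<close> is even and at least 3, it is at least 4, so that \<open>m - 1 \<ge> 1\<close>.\<close>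
    have j: "1 \<le> m - 1" "real (m - 1) < real n / 2" "lam n (m - 1) = 0"
      using lam0[of "m - 1"] assms m by auto
    show "{billiard n j | j. 1 \<le> j \<and> real j < real n / 2 \<and> lam n j = 0}
      = {centrally_projective_billiard n}"
      using j billiard_eq_central_iff[OF assms] by force
  qed
  assume odd: "odd n"
  show "centrally_projective_billiard n \<notin> billiard_family n"
  proof
    assume "centrally_projective_billiard n \<in> billiard_family n"
    then obtain j where j: "1 \<le> j" "real j < real n / 2"
      "billiard n j = centrally_projective_billiard n"
      by (auto simp: billiard_family_def)
    then have "n = 2 * j + 2" using lam0 billiard_eq_central_iff[OF assms] by blast
    with odd show False by simp
  qed
qed

end
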